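(* Let $s\in(s_0,1]$ and let $(U^n)_{n\ge0}\subset\mathbb R^{N-1}$ be generated by the semi-implicit full-discrete scheme $$\frac{U^{n+1}-U^n}{\tau}+\frac{\epsilon^2}{h}\,\boldsymbol S\,U^{n+1}+f(U^n)=0,\qquad n\ge0,$$ with initial value $U^0_j=u_0(x_j)$, $1\le j\le N-1$. If $0\le u_0(x)\le1$ and the time step size satisfies $0<\tau\le2$, then the scheme preserves the maximum principle in the sense that $0\le U^n_j\le1$ for $1\le j\le N-1$ (and all $n$).
   Context: Let $\Omega=(a,b)$, $N\ge2$ an integer, $h=(b-a)/N$, $x_j=a+jh$, and $\epsilon>0$ a constant. $s_0\approx0.2374$ is the unique root in $(0,\frac12)$ of $7+3^{3-2s}-2^{5-2s}=0$. $f(u)=\frac{u(u-1)(2u-1)}2$, applied componentwise to vectors. $\boldsymbol S$ is the $(N-1)\times(N-1)$ stiffness matrix of the fractional Laplacian for piecewise linear finite elements: for $s\ne\frac12$, $S_{kj}=\frac{h^{1-2s}}{2\Gamma(4-2s)\cos(s\pi)}\,t_{|k-j|}$ with $t_p=\sum_{i=-2}^2c_i|p+i|^{3-2s}$, $c_0=6$, $c_{\pm1}=-4$, $c_{\pm2}=1$; for $s=\frac12$, $S_{kj}=\frac1{2\pi}\sum_{i=-2}^2c_i(p+i)^2\ln|p+i|$ with $p=|k-j|$ and $0^2\ln0=0$. The scheme is the matrix form of: find $u_h^{n+1}$ in the span of the hat functions $\phi_j$ with $\frac1\tau(I_h((u_h^{n+1}-u_h^n)v_h),1)_\Omega+\epsilon^2((-\Delta)^su_h^{n+1},v_h)_\Omega+(I_h(f(u_h^n)v_h),1)_\Omega=0$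 for all $v_h$ in that span, where $I_h$ is piecewise linear nodal interpolation at $x_1,\dots,x_{N-1}$ and $U^n=(u_h^n(x_1),\dots,u_h^n(x_{N-1}))^T$; it discretizes $u_t+\epsilon^2(-\Delta)^su+f(u)=0$ in $\Omega$, $u=0$ on $\mathbb R\setminus\Omega$, $u(\cdot,0)=u_0$. *)

theory Defs
  imports "HOL-Analysis.Analysis" "Jordan_Normal_Form.Matrix"
begin

text \<open>Vectors and matrices are those of \<^theory>\<open>Jordan_Normal_Form.Matrix\<close>, whose dimension is a
  natural number; the homonymous syntax of \<^theory>\<open>HOL-Analysis.Finite_Cartesian_Product\<close> is
  switched off.\<close>

hide_type (open) Finite_Cartesian_Product.vec
hide_const (open) Finite_Cartesian_Product.vec
unbundle no vec_syntax

definition s0_fun :: "real \<Rightarrow> real" where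
  "s0_fun s = 7 + 3 powr (3 - 2 * s) - 2 powr (5 - 2 * s)"

definition s0 :: real where
  "s0 = (THE s. 0 < s \<and> s < 1 / 2 \<and> s0_fun s = 0)"

lemma s0_fun_deriv:
  "(s0_fun has_real_derivative
     (2 * ln 2 * 2 powr (5 - 2 * s) - 2 * ln 3 * 3 powr (3 - 2 * s))) (at s)"
  unfolding s0_fun_def by (auto intro!: derivative_eq_intros)

lemma s0_ex1: "\<exists>!s. 0 < s \<and> s < 1 / 2 \<and> s0_fun s = 0"
proof -
  let ?d = "\<lambda>s::real. 2 * ln 2 * 2 powr (5 - 2 * s) - 2 * ln 3 * 3 powr (3 - 2 * s)"
  have half: "s0_fun (1/2) = 0"
    by (simp add: s0_fun_def)
  have cont: "continuous_on A s0_fun" for A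
    using s0_fun_deriv DERIV_isCont continuous_at_imp_continuous_on by blast
  have "(3::real) ^ 9 < 2 ^ 16" by simp
  then have "ln ((3::real) ^ 9) < ln (2 ^ 16)" by (subst ln_less_cancel_iff) auto
  then have "real 9 * ln 3 < real 16 * ln 2" by (subst (asm) (1 2) ln_realpow) auto
  then have "?d (1/2) > 0" by simp
  from DERIV_pos_inc_left[OF s0_fun_deriv this] obtain e where
    e: "e > 0" "\<And>t. 0 < t \<Longrightarrow> t < e \<Longrightarrow> s0_fun (1/2 - t) < s0_fun (1/2)" by blast
  define t where "t = min (e/2) (1/4)"
  have t: "0 < t" "t < e" "t < 1/2" using e(1) by (auto simp: t_def)
  have neg: "s0_fun (1/2 - t) < 0" using e(2) t half by simp
  have "\<exists>s. 0 \<le> s \<and> s \<le> 1/2 - t \<and> s0_fun s = 0"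
    by (rule IVT2') (use neg t cont in \<open>auto simp: s0_fun_def\<close>)
  then obtain s where "0 \<le> s" "s \<le> 1/2 - t" "s0_fun s = 0" by blast
  moreover have "s0_fun 0 \<noteq> 0" by (simp add: s0_fun_def)
  ultimately have ex: "0 < s \<and> s < 1/2 \<and> s0_fun s = 0" using t by (cases "s = 0") auto
  have inj: "z = w" if "?d z = 0" "?d w = 0" for z w
  proof -
    have *: "ln (ln 2) + (5 - 2 * y) * ln 2 = ln (ln 3) + (3 - 2 * y) * ln 3"
      if "?d y = 0" for y :: real
    proof -
      have "ln 2 * 2 powr (5 - 2 * y) = ln 3 * 3 powr (3 - 2 * y)" using that by simp
      then have "ln (ln 2 * 2 powr (5 - 2 * y)) = ln (ln 3 * 3 powr (3 - 2 * y))" by simp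
      then show ?thesis by (simp add: ln_mult ln_powr)
    qed
    have "2 * (z - w) * (ln 3 - ln 2) = 0"
      using *[OF that(1)] *[OF that(2)] by (simp add: algebra_simps)
    then show ?thesis by simp
  qed
  have no: False if "u < v" "v < 1/2" "s0_fun u = 0" "s0_fun v = 0" for u v
  proof -
    have "\<exists>z. u < z \<and> z < v \<and> s0_fun v - s0_fun u = (v - u) * ?d z"
      using that s0_fun_deriv by (intro MVT2) auto
    then obtain z where z: "u < z" "z < v" "s0_fun v - s0_fun u = (v - u) * ?d z" by blast
    have dz: "?d z = 0" using z(3) that by (metis diff_self less_irrefl mult_eq_0_iff right_minus_eq)
    have "\<exists>w. v < w \<and> w < 1/2 \<and> s0_fun (1/2) - s0_fun v = (1/2 - v) * ?d w"
      using that s0_fun_deriv by (intro MVT2) auto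
    then obtain w where w: "v < w" "s0_fun (1/2) - s0_fun v = (1/2 - v) * ?d w" by blast
    have dw: "?d w = 0"
      using w(2) that half by (metis diff_self less_irrefl mult_eq_0_iff right_minus_eq)
    show False using inj[OF dz dw] z w by simp
  qed
  show ?thesis
    using ex no by (metis linorder_neqE)
qed

text \<open>The fourth-order difference weights \<open>c\<^sub>i\<close>, \<open>-2 \<le> i \<le> 2\<close>.\<close>

definition diff_coeff :: "int \<Rightarrow> real" where
  "diff_coeff i = (if i = 0 then 6 else if \<bar>i\<bar> = 1 then - 4 else if \<bar>i\<bar> = 2 then 1 else 0)"

text \<open>The entry of the stiffness matrix at distance \<open>p = \<bar>k - j\<bar>\<close> from the diagonal. At zero,
  \<open>0 powr r = 0\<close> and \<open>0\<^sup>2 * ln 0 = 0\<close>, as intended.\<close>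

definition stiffness_entry :: "real \<Rightarrow> real \<Rightarrow> int \<Rightarrow> real" where
  "stiffness_entry s h p =
     (if s = 1 / 2
      then 1 / (2 * pi) * (\<Sum>i = - 2..2. diff_coeff i * (of_int (p + i))\<^sup>2 * ln \<bar>of_int (p + i)\<bar>)
      else h powr (1 - 2 * s) / (2 * Gamma (4 - 2 * s) * cos (s * pi)) *
           (\<Sum>i = - 2..2. diff_coeff i * \<bar>of_int (p + i)\<bar> powr (3 - 2 * s)))"

text \<open>Rows and columns are counted from \<open>0\<close>: index \<open>k\<close> belongs to the interior node \<open>x\<^sub>k\<^sub>+\<^sub>1\<close>.\<close>

definition stiffness_mat :: "real \<Rightarrow> real \<Rightarrow> nat \<Rightarrow> real mat" where
  "stiffness_mat s h N =
     mat (N - 1) (N - 1) (\<lambda>(k, j). stiffness_entry s h \<bar>int k - int j\<bar>)"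

definition reaction :: "real \<Rightarrow> real" where
  "reaction u = u * (u - 1) * (2 * u - 1) / 2"

definition mesh_size :: "real \<Rightarrow> real \<Rightarrow> nat \<Rightarrow> real" where
  "mesh_size a b N = (b - a) / real N"

definition mesh_node :: "real \<Rightarrow> real \<Rightarrow> nat \<Rightarrow> nat \<Rightarrow> real" where
  "mesh_node a b N j = a + real j * mesh_size a b N"

end

theory Submission
  imports Defs "HOL-Real_Asymp.Real_Asymp"
begin

text \<open>
  Multiplied by \<open>\<tau>\<close>, one step of the scheme reads \<open>V + c S V = W\<close> with \<open>V\<close> the new vector,
  \<open>c = \<tau> \<epsilon>\<^sup>2 / h \<ge> 0\<close>, and \<open>W\<^sub>k = U\<^sub>k - \<tau> f(U\<^sub>k)\<close> for the old vector \<open>U\<close>. For \<open>\<tau> \<le> 2\<close> the map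
  \<open>u \<mapsto> u - \<tau> f(u)\<close> sends the unit interval into itself (\<open>explicit_reaction_unit_interval\<close>). The implicit
  part keeps the unit interval as soon as \<open>S\<close> has nonpositive off-diagonal entries and nonnegative row
  sums: at an index where \<open>V\<close> is least, \<open>(S V)\<^sub>k\<close> is at most the row sum times \<open>V\<^sub>k\<close>, so a negative
  minimum would make \<open>W\<^sub>k\<close> negative; the upper bound is the same argument for \<open>1 - V\<close>
  (\<open>implicit_step_unit_interval\<close>).

  The work lies in these two sign properties of \<open>S\<close>. Its entries are the central fourth differences at
  \<open>k - j\<close> of the even function \<open>x \<mapsto> g \<bar>x\<bar>\<close>, where \<open>g x\<close> is a multiple of \<open>x\<close> to the power \<open>3 - 2 s\<close>, or
  of \<open>x\<^sup>2 ln x\<close> when \<open>s = 1 / 2\<close>. On the positive half line the third derivative of \<open>g\<close> is nonnegative and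
  the fourth one is nonpositive: the factor \<open>3 - 2 s - 2\<close> in the derivatives of the power changes sign at
  \<open>s = 1 / 2\<close>, exactly where \<open>cos (s \<pi>)\<close> does. The mean value theorem carries these signs over to
  the differences whose stencil stays in the half line; this settles all entries at distance at least 2
  from the diagonal. A row sum telescopes to a sum of two third differences at the ends of the row, which
  are nonnegative by the same argument, or by \<open>4 g 1 \<le> g 2\<close> when the stencil crosses the origin.

  At distance 1 the stencil crosses the singularity of \<open>g \<bar>x\<bar>\<close> at the origin. For \<open>s = 1 / 2\<close> the
  sign of the entry is the inequality \<open>9 ln 3 \<le> 16 ln 2\<close>; otherwise the entry is a multiple of \<open>s0_fun s\<close>. This is where the threshold \<open>s0\<close> comes from. With \<open>X\<close> for 2 to the power \<open>3 - 2 s\<close>, the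
  function \<open>s0_fun\<close> becomes a convex function of \<open>X\<close>, and its zeros \<open>s0\<close> and \<open>1 / 2\<close>
  fix its sign between them and beyond (\<open>s0_fun_sign\<close>).
\<close>

section \<open>Iterated differences and derivatives\<close>

definition forward_difference :: "(real \<Rightarrow> real) \<Rightarrow> real \<Rightarrow> real" where
  "forward_difference f x = f (x + 1) - f x"

lemma has_real_derivative_iterated_difference:
  assumes "\<And>x. x > a \<Longrightarrow> (f has_real_derivative f' x) (at x)" and "x > a"
  shows "((forward_difference ^^ n) f has_real_derivative (forward_difference ^^ n) f' x) (at x)"
  using assms(2)
proof (induction n arbitrary: x)
  case 0
  then show ?case by (simp add: assms(1))
next
  case (Suc n)
  have "((\<lambda>x. (forward_difference ^^ n) f (x + 1)) has_real_derivative
      (forward_difference ^^ n) f' (x + 1)) (at x)"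
    using Suc.IH[of "x + 1"] Suc.prems by (simp add: DERIV_shift)
  from DERIV_diff[OF this Suc.IH[OF Suc.prems]] show ?case
    by (simp add: forward_difference_def[abs_def])
qed

lemma continuous_on_iterated_difference:
  assumes "continuous_on {a..} f"
  shows "continuous_on {a..} ((forward_difference ^^ n) f)"
proof (induction n)
  case 0
  then show ?case by (simp add: assms)
next
  case (Suc n)
  have "continuous_on {a..} (\<lambda>x. (forward_difference ^^ n) f (x + 1))"
    by (rule continuous_on_compose2[OF Suc.IH]) (auto intro!: continuous_intros)
  then show ?case
    using Suc.IH by (auto simp: forward_difference_def[abs_def] intro!: continuous_intros)
qed

text \<open>Peeling off one difference at a time, the mean value theorem trades a difference for a derivative
  and moves the evaluation point strictly to the right, so that continuity suffices at the left end \<open>a\<close>.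
  This matters because the profiles below have singular derivatives at the
  origin, which the stencil at distance 2 from the diagonal touches. The derivatives are given as an
  explicit sequence \<open>F\<close>, with strict inequality for \<open>\<xi>\<close> so that their signs are needed on the open
  half line only.\<close>

lemma iterated_difference_eq_derivative:
  assumes "n > 0 \<Longrightarrow> continuous_on {a..} (F 0)"
    and "\<And>k x. k < n \<Longrightarrow> x > a \<Longrightarrow> (F k has_real_derivative F (Suc k) x) (at x)"
    and "x \<ge> a"
  shows "\<exists>\<xi>\<ge>x. (n > 0 \<longrightarrow> \<xi> > x) \<and> (forward_difference ^^ n) (F 0) x = F n \<xi>"
  using assms
proof (induction n arbitrary: F a x)
  case 0
  then show ?case by auto
next
  case (Suc n)
  let ?D = "\<lambda>k. (forward_difference ^^ n) (F k)"
  have deriv: "(?D 0 has_real_derivative ?D 1 y) (at y)" if "y > a" for y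
    using has_real_derivative_iterated_difference[of a "F 0" "F 1" y n] Suc.prems(2)[of 0] that
    by simp
  have "continuous_on {x..x + 1} (?D 0)"
    by (rule continuous_on_subset[OF continuous_on_iterated_difference[OF Suc.prems(1)]])
       (use Suc.prems(3) in auto)
  moreover have "(?D 0) differentiable (at y)" if "x < y" "y < x + 1" for y
    using deriv[of y] that Suc.prems(3) by (auto simp: real_differentiable_def)
  ultimately obtain l y where y: "x < y" "y < x + 1"
      "(?D 0 has_real_derivative l) (at y)" "?D 0 (x + 1) - ?D 0 x = (x + 1 - x) * l"
    using MVT[of x "x + 1" "?D 0"] by auto
  have "l = ?D 1 y"
    using DERIV_unique[OF y(3) deriv] y(1) Suc.prems(3) by simp
  then have step: "(forward_difference ^^ Suc n) (F 0) x = ?D 1 y"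
    using y(4) by (simp add: forward_difference_def)
  have "continuous_on {y..} (F 1)" if "n > 0"
    by (rule DERIV_continuous_on[of _ _ "F 2"], rule has_field_derivative_at_within)
       (use Suc.prems(2)[of 1] Suc.prems(3) y(1) that in \<open>auto simp: numeral_2_eq_2\<close>)
  then obtain \<xi> where "\<xi> \<ge> y" "?D 1 y = F (Suc n) \<xi>"
    using Suc.IH[of y "\<lambda>k. F (Suc k)" y] Suc.prems(2,3) y(1) by auto
  then show ?case using step y(1) by (intro exI[of _ \<xi>]) simp
qed

lemma iterated_difference_3_4:
  "(forward_difference ^^ 3) f x = f (x + 3) - 3 * f (x + 2) + 3 * f (x + 1) - f x"
  "(forward_difference ^^ 4) f x = f (x + 4) - 4 * f (x + 3) + 6 * f (x + 2) - 4 * f (x + 1) + f x"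
  by (simp_all add: forward_difference_def numeral_eq_Suc algebra_simps)

section \<open>Toeplitz matrices of fourth differences\<close>

text \<open>The central fourth difference at \<open>p\<close> of the even extension of \<open>g\<close> from the half line.\<close>

definition even_fourth_difference :: "(real \<Rightarrow> real) \<Rightarrow> int \<Rightarrow> real" where
  "even_fourth_difference g p = (\<Sum>i = - 2..2. diff_coeff i * g \<bar>of_int (p + i)\<bar>)"

lemma even_fourth_difference_eq:
  "even_fourth_difference g p = 6 * g \<bar>of_int p\<bar> - 4 * g \<bar>of_int p + 1\<bar> - 4 * g \<bar>of_int p - 1\<bar>
     + g \<bar>of_int p + 2\<bar> + g \<bar>of_int p - 2\<bar>"
proof -
  have "{- 2..2 :: int} = {- 2, - 1, 0, 1, 2}" by auto
  then show ?thesis by (simp add: even_fourth_difference_def diff_coeff_def)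
qed

lemma even_fourth_difference_abs:
  "even_fourth_difference g \<bar>p\<bar> = even_fourth_difference g p"
proof (cases "p \<ge> 0")
  case False
  have "\<bar>real_of_int (- p) + c\<bar> = \<bar>real_of_int p - c\<bar>" "\<bar>real_of_int (- p) - c\<bar> = \<bar>real_of_int p + c\<bar>"
    for c by (simp_all add: abs_if)
  then show ?thesis using False by (simp only: even_fourth_difference_eq) simp
qed simp

text \<open>The sign conditions on \<open>g\<close> under which the matrix of its fourth differences has nonpositive
  off-diagonal entries and nonnegative row sums. The differences \<open>third\<close> and \<open>fourth\<close> see \<open>g\<close> on the
  half line only; \<open>corner\<close> and \<open>neighbour\<close> are the stencils that reach across the origin, simplified with
  the evenness of the extension and \<open>g 0 = 0\<close>.\<close>

locale stiffness_profile =
  fixes g :: "real \<Rightarrow> real"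
  assumes zero: "g 0 = 0"
    and third: "\<And>x. x \<ge> 0 \<Longrightarrow> (forward_difference ^^ 3) g x \<ge> 0"
    and fourth: "\<And>x. x \<ge> 0 \<Longrightarrow> (forward_difference ^^ 4) g x \<le> 0"
    and corner: "4 * g 1 \<le> g 2"
    and neighbour: "7 * g 1 - 4 * g 2 + g 3 \<le> 0"
begin

lemma off_diagonal_nonpos:
  assumes "p > 0"
  shows "even_fourth_difference g p \<le> 0"
proof (cases "p = 1")
  case True
  then show ?thesis using neighbour zero by (simp add: even_fourth_difference_eq)
next
  case False
  with assms have "p \<ge> 2" by simp
  then have "real_of_int p \<ge> 2" by simp
  then show ?thesis
    using fourth[of "of_int p - 2"]
    by (simp add: even_fourth_difference_eq iterated_difference_3_4 algebra_simps)
qed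

text \<open>The third difference of the even extension. The fourth difference is the divergence of this flux,
  so that row sums telescope.\<close>

definition flux :: "int \<Rightarrow> real" where
  "flux p = g \<bar>of_int p + 2\<bar> - 3 * g \<bar>of_int p + 1\<bar> + 3 * g \<bar>of_int p\<bar> - g \<bar>of_int p - 1\<bar>"

lemma flux_nonneg:
  assumes "p \<ge> 0"
  shows "flux p \<ge> 0"
proof (cases "p = 0")
  case True
  then show ?thesis using corner zero by (simp add: flux_def)
next
  case False
  with assms have "p \<ge> 1" by simp
  then have "real_of_int p \<ge> 1" by simp
  then show ?thesis
    using third[of "of_int p - 1"]
    by (simp add: flux_def iterated_difference_3_4 algebra_simps)
qed

text \<open>An odd difference of an even function is odd about the centre of its stencil, and the centre here is
  \<open>p + 1 / 2\<close>. So the flux through the far end of a row, where the argument is negative, contributes with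
  the same sign as the one through the near end.\<close>

lemma flux_reflect: "flux (- p - 1) = - flux p"
proof -
  have "\<bar>- real_of_int p - 1 + 2\<bar> = \<bar>real_of_int p - 1\<bar>"
    "\<bar>- real_of_int p - 1 + 1\<bar> = \<bar>real_of_int p\<bar>"
    "\<bar>- real_of_int p - 1\<bar> = \<bar>real_of_int p + 1\<bar>"
    "\<bar>- real_of_int p - 1 - 1\<bar> = \<bar>real_of_int p + 2\<bar>"
    by linarith+
  then show ?thesis by (simp add: flux_def)
qed

lemma row_sum_eq_flux:
  "(\<Sum>j<n. even_fourth_difference g \<bar>k - int j\<bar>) = flux k - flux (k - int n)"
proof (induction n)
  case (Suc n)
  have "even_fourth_difference g p = flux p - flux (p - 1)" for p
    by (simp add: even_fourth_difference_eq flux_def algebra_simps)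
  from this[of "k - int n"] show ?case
    using Suc by (simp add: even_fourth_difference_abs diff_diff_eq add.commute)
qed simp

lemma row_sum_nonneg:
  assumes "k < n"
  shows "(\<Sum>j<n. even_fourth_difference g \<bar>int k - int j\<bar>) \<ge> 0"
proof -
  have "int k - int n = - (int n - 1 - int k) - 1" by simp
  then have "flux (int k - int n) = - flux (int n - 1 - int k)"
    using flux_reflect by metis
  then show ?thesis
    using flux_nonneg[of "int k"] flux_nonneg[of "int n - 1 - int k"] assms
    by (simp add: row_sum_eq_flux)
qed

end

lemma stiffness_profileI:
  assumes "F 0 = g" and "continuous_on {0..} g"
    and deriv: "\<And>k x. k < 4 \<Longrightarrow> x > 0 \<Longrightarrow> (F k has_real_derivative F (Suc k) x) (at x)"
    and "\<And>x. x > 0 \<Longrightarrow> F 3 x \<ge> 0" and "\<And>x. x > 0 \<Longrightarrow> F 4 x \<le> 0"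
    and "g 0 = 0" and "4 * g 1 \<le> g 2" and "7 * g 1 - 4 * g 2 + g 3 \<le> 0"
  shows "stiffness_profile g"
proof
  fix x :: real assume x: "x \<ge> 0"
  show "(forward_difference ^^ 3) g x \<ge> 0"
    using iterated_difference_eq_derivative[of 3 0 F x] assms x by fastforce
  show "(forward_difference ^^ 4) g x \<le> 0"
    using iterated_difference_eq_derivative[of 4 0 F x] assms x by fastforce
qed (use assms in auto)

section \<open>The profiles of the fractional Laplacian\<close>

text \<open>The defining inequality of convexity, cleared of denominators, so that it can be read as a bound
  on the value at any one of the three points.\<close>

lemma convex_on_three_points:
  fixes f :: "real \<Rightarrow> real"
  assumes "convex_on I f" and "x \<in> I" "z \<in> I" and "x < y" "y < z"
  shows "(z - x) * f y \<le> (z - y) * f x + (y - x) * f z"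
proof -
  define t where "t = (y - x) / (z - x)"
  have t: "t * (z - x) = y - x" using assms by (simp add: t_def)
  then have "(1 - t) * x + t * z = y" by (simp only: algebra_simps)
  moreover have "f ((1 - t) *\<^sub>R x + t *\<^sub>R z) \<le> (1 - t) * f x + t * f z"
    by (rule convex_onD[OF assms(1)]) (use assms in \<open>auto simp: t_def\<close>)
  ultimately have "f y \<le> (1 - t) * f x + t * f z" by simp
  then have "(z - x) * f y \<le> (z - x) * ((1 - t) * f x + t * f z)"
    using assms by (intro mult_left_mono) auto
  also have "\<dots> = ((z - x) - t * (z - x)) * f x + t * (z - x) * f z"
    by (simp add: algebra_simps)
  also have "\<dots> = (z - y) * f x + (y - x) * f z" unfolding t by simp
  finally show ?thesis .
qed

lemma s0_root: "0 < s0" "s0 < 1 / 2" "s0_fun s0 = 0"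
  using theI'[OF s0_ex1] unfolding s0_def by auto

text \<open>Writing \<open>X\<close> for 2 to the power \<open>3 - 2 s\<close> turns \<open>s0_fun\<close> into \<open>7 - 4 X\<close> plus a power of \<open>X\<close> with
  exponent \<open>log 2 3 > 1\<close>, which is convex. A convex function with two zeros is nonpositive between them and
  nonnegative outside; the zeros are the images of \<open>1 / 2\<close> and \<open>s0\<close>.\<close>

lemma s0_fun_sign:
  assumes "s0 < s"
  shows "s < 1 / 2 \<Longrightarrow> s0_fun s \<le> 0" and "1 / 2 < s \<Longrightarrow> s0_fun s \<ge> 0"
proof -
  let ?F = "\<lambda>X::real. X powr (log 2 3) + (7 - 4 * X)"
  let ?X = "\<lambda>s::real. 2 powr (3 - 2 * s)"
  have conv: "convex_on {0<..} ?F"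
  proof (rule convex_on_add)
    show "convex_on {0<..} (\<lambda>x::real. x powr log 2 3)"
      by (rule powr_convex) simp
    show "convex_on {0<..} (\<lambda>X::real. 7 - 4 * X)"
      by (intro convex_onI) (auto simp: algebra_simps)
  qed
  have F: "?F (?X t) = s0_fun t" for t
  proof -
    have "(?X t) powr (log 2 3) = (2 powr (log 2 3)) powr (3 - 2 * t)"
      by (simp only: powr_powr mult.commute)
    also have "\<dots> = 3 powr (3 - 2 * t)" by simp
    finally have "(?X t) powr (log 2 3) = 3 powr (3 - 2 * t)" .
    moreover have "2 powr (5 - 2 * t) = 4 * ?X t"
      using powr_add[of 2 2 "3 - 2 * t"] by simp
    ultimately show ?thesis by (simp add: s0_fun_def)
  qed
  have half: "s0_fun (1 / 2) = 0" by (simp add: s0_fun_def)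
  have less: "?X t < ?X u" if "u < t" for t u using that by simp
  have pos: "?X t \<in> {0<..}" for t by simp
  \<comment> \<open>The substitution reverses the order, so \<open>s0\<close> always gives the right end of the three points.\<close>
  show "s0_fun s \<le> 0" if "s < 1 / 2"
    using convex_on_three_points[OF conv pos[of "1/2"] pos[of s0] less[OF that] less[OF assms]]
      less[of s0 "1/2"] s0_root half unfolding F by (simp add: mult_le_0_iff)
  show "s0_fun s \<ge> 0" if "1 / 2 < s"
    using convex_on_three_points[OF conv pos[of s] pos[of s0] less[OF that] less[OF s0_root(2)]]
      less[of s0 "1/2"] s0_root half unfolding F by (simp add: zero_le_mult_iff)
qed

text \<open>The third derivative carries the factor \<open>\<alpha> (\<alpha> - 1) (\<alpha> - 2)\<close> and the fourth one the additional
  factor \<open>\<alpha> - 3 < 0\<close>. Only the factor \<open>\<alpha> - 2\<close> has a variable sign, and \<open>c\<close> is assumed to compensate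
  for it.\<close>

lemma power_profile:
  assumes \<alpha>: "1 \<le> \<alpha>" "\<alpha> < 3" and c: "0 \<le> c * (\<alpha> - 2)"
    and "c * (2 powr \<alpha> - 4) \<ge> 0" and "c * (7 - 4 * 2 powr \<alpha> + 3 powr \<alpha>) \<le> 0"
  shows "stiffness_profile (\<lambda>x. c * x powr \<alpha>)"
proof (rule stiffness_profileI)
  let ?F = "\<lambda>(k::nat) x::real. c * (\<Prod>i<k. \<alpha> - real i) * x powr (\<alpha> - real k)"
  show "?F 0 = (\<lambda>x. c * x powr \<alpha>)" by simp
  show "continuous_on {0..} (\<lambda>x. c * x powr \<alpha>)"
    using \<alpha> by (intro continuous_intros continuous_on_powr') auto
  show "(?F k has_real_derivative ?F (Suc k) x) (at x)" if "x > 0" for k x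
    using that by (auto intro!: derivative_eq_intros simp: algebra_simps)
  have three: "c * (\<Prod>i<3. \<alpha> - real i) = (c * (\<alpha> - 2)) * (\<alpha> * (\<alpha> - 1))"
    by (simp add: numeral_eq_Suc)
  have four: "c * (\<Prod>i<4. \<alpha> - real i) = (c * (\<alpha> - 2)) * (\<alpha> * (\<alpha> - 1)) * (\<alpha> - 3)"
    by (simp add: numeral_eq_Suc)
  have "(c * (\<alpha> - 2)) * (\<alpha> * (\<alpha> - 1)) \<ge> 0"
    by (rule mult_nonneg_nonneg[OF c]) (use \<alpha> in simp)
  note sign = this
  show "?F 3 x \<ge> 0" for x
    unfolding three by (rule mult_nonneg_nonneg[OF sign]) simp
  show "?F 4 x \<le> 0" for x
    unfolding four
    by (rule mult_nonpos_nonneg, rule mult_nonneg_nonpos[OF sign]) (use \<alpha> in auto)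
qed (use assms in \<open>auto simp: algebra_simps\<close>)

lemma log_profile: "stiffness_profile (\<lambda>x. x\<^sup>2 * ln x / (2 * pi))"
proof (rule stiffness_profileI)
  let ?F = "\<lambda>(k::nat) x::real. [x\<^sup>2 * ln x, 2 * x * ln x + x, 2 * ln x + 3, 2 / x, - 2 / x\<^sup>2] ! k / (2 * pi)"
  show "?F 0 = (\<lambda>x. x\<^sup>2 * ln x / (2 * pi))" by simp
  have "continuous_on {0..} (\<lambda>x::real. x\<^sup>2 * ln x)"
    unfolding continuous_on_eq_continuous_within
  proof
    fix x :: real assume "x \<in> {0..}"
    show "continuous (at x within {0..}) (\<lambda>x. x\<^sup>2 * ln x)"
    proof (cases "x = 0")
      case True
      have "((\<lambda>x::real. x\<^sup>2 * ln x) \<longlongrightarrow> 0) (at_right 0)" by real_asymp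
      then show ?thesis
        using True by (simp add: continuous_within at_within_Ici_at_right)
    next
      case False
      then show ?thesis using \<open>x \<in> {0..}\<close> by (auto intro!: continuous_intros)
    qed
  qed
  then show "continuous_on {0..} (\<lambda>x::real. x\<^sup>2 * ln x / (2 * pi))"
    by (rule continuous_on_divide) auto
  show "(?F k has_real_derivative ?F (Suc k) x) (at x)" if "k < 4" "x > 0" for k x
  proof -
    from \<open>k < 4\<close> consider "k = 0" | "k = 1" | "k = 2" | "k = 3" by linarith
    then show ?thesis
      by cases (use \<open>x > 0\<close> in \<open>auto intro!: derivative_eq_intros
        simp: field_simps power2_eq_square numeral_eq_Suc\<close>)
  qed
  \<comment> \<open>The neighbour condition is \<open>9 ln 3 \<le> 16 ln 2\<close>, that is \<open>19683 \<le> 65536\<close>.\<close>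
  have "ln ((3::real) ^ 9) \<le> ln (2 ^ 16)" by (subst ln_le_cancel_iff) auto
  then have "9 * ln 3 \<le> (16::real) * ln 2"
    by (subst (asm) (1 2) ln_realpow) auto
  then show "7 * (1\<^sup>2 * ln 1 / (2 * pi)) - 4 * (2\<^sup>2 * ln 2 / (2 * pi)) + 3\<^sup>2 * ln 3 / (2 * pi) \<le> (0::real)"
    by (simp add: field_simps)
qed auto

definition fractional_profile :: "real \<Rightarrow> real \<Rightarrow> real \<Rightarrow> real" where
  "fractional_profile s h x =
     (if s = 1 / 2 then x\<^sup>2 * ln x / (2 * pi)
      else h powr (1 - 2 * s) / (2 * Gamma (4 - 2 * s) * cos (s * pi)) * x powr (3 - 2 * s))"

lemma stiffness_entry_eq: "stiffness_entry s h p = even_fourth_difference (fractional_profile s h) p"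
  unfolding stiffness_entry_def even_fourth_difference_def fractional_profile_def
  by (auto simp: sum_distrib_left sum_divide_distrib intro!: sum.cong)

text \<open>At \<open>s = 1 / 2\<close> the constant changes sign with the cosine. At the same place the
  exponent \<open>3 - 2 s\<close> passes 2 and \<open>s0_fun\<close> changes sign, so the products keep theirs.\<close>

lemma stiffness_profile_fractional:
  assumes s: "s0 < s" "s \<le> 1" and "h > 0"
  shows "stiffness_profile (fractional_profile s h)"
proof (cases "s = 1 / 2")
  case True
  then show ?thesis using log_profile by (simp add: fractional_profile_def[abs_def])
next
  case False
  define c where "c = h powr (1 - 2 * s) / (2 * Gamma (4 - 2 * s) * cos (s * pi))"
  have G: "Gamma (4 - 2 * s) > 0" using s by (intro Gamma_real_pos) simp
  have id: "7 - 4 * 2 powr (3 - 2 * s) + 3 powr (3 - 2 * s) = s0_fun s"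
    using powr_add[of 2 2 "3 - 2 * s"] by (simp add: s0_fun_def)
  have four: "(4::real) = 2 powr 2" by simp
  have "c * (3 - 2 * s - 2) \<ge> 0 \<and> c * (2 powr (3 - 2 * s) - 4) \<ge> 0 \<and> c * s0_fun s \<le> 0"
  proof (cases "s < 1 / 2")
    case True
    have "cos (s * pi) > 0"
      using True s s0_root(1) by (intro cos_gt_zero_pi) (auto intro: less_trans[of _ 0] mult_pos_pos)
    then have "c \<ge> 0" using G \<open>h > 0\<close> by (simp add: c_def)
    moreover have "2 powr (3 - 2 * s) \<ge> (4::real)"
      unfolding four using True by (subst powr_le_cancel_iff) auto
    ultimately show ?thesis
      using True s0_fun_sign(1)[OF s(1)] by (auto intro: mult_nonneg_nonpos)
  next
    case big: False
    have "cos (pi - s * pi) > 0"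
    proof (rule cos_gt_zero_pi)
      have "s * pi \<le> 1 * pi" using s by (intro mult_right_mono) auto
      then show "- (pi / 2) < pi - s * pi" using pi_gt_zero by linarith
      have "(1 / 2) * pi < s * pi" using big False by (intro mult_strict_right_mono) auto
      then show "pi - s * pi < pi / 2" by simp
    qed
    then have "cos (s * pi) < 0" by (simp add: cos_diff)
    then have "c \<le> 0"
      using G \<open>h > 0\<close> unfolding c_def by (intro divide_nonneg_nonpos mult_nonneg_nonpos) auto
    moreover have "2 powr (3 - 2 * s) \<le> (4::real)"
      unfolding four using big by (subst powr_le_cancel_iff) auto
    ultimately show ?thesis
      using big False s0_fun_sign(2)[OF s(1)] by (auto intro: mult_nonpos_nonpos mult_nonpos_nonneg)
  qed
  then have "stiffness_profile (\<lambda>x. c * x powr (3 - 2 * s))"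
    using s s0_root(1) by (intro power_profile) (auto simp: id)
  then show ?thesis using False by (simp add: fractional_profile_def[abs_def] c_def)
qed

section \<open>The discrete maximum principle\<close>

text \<open>At an index \<open>m\<close> where \<open>v\<close> is least, every off-diagonal term \<open>A m j * v j\<close> is at most \<open>A m j * v m\<close>, so
  the whole row is at most its sum times \<open>v m\<close>. If \<open>v m\<close> were negative, both summands of the hypothesis on
  \<open>m\<close> would be nonpositive and the first one negative.\<close>

lemma implicit_step_nonneg:
  fixes A :: "'i \<Rightarrow> 'i \<Rightarrow> real"
  assumes "finite I" and "c \<ge> 0"
    and off: "\<And>i j. i \<in> I \<Longrightarrow> j \<in> I \<Longrightarrow> i \<noteq> j \<Longrightarrow> A i j \<le> 0"
    and row: "\<And>i. i \<in> I \<Longrightarrow> (\<Sum>j\<in>I. A i j) \<ge> 0"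
    and w: "\<And>i. i \<in> I \<Longrightarrow> v i + c * (\<Sum>j\<in>I. A i j * v j) \<ge> 0"
    and "i \<in> I"
  shows "v i \<ge> 0"
proof -
  have "I \<noteq> {}" using \<open>i \<in> I\<close> by auto
  then obtain m where m: "m \<in> I" "\<And>j. j \<in> I \<Longrightarrow> v m \<le> v j"
    using ex_min_if_finite[of "v ` I"] \<open>finite I\<close> by (force simp: not_less)
  have "v m \<ge> 0"
  proof (rule ccontr)
    assume neg: "\<not> v m \<ge> 0"
    have "A m j * v j \<le> A m j * v m" if "j \<in> I" for j
      using off[of m j] m that by (cases "j = m") (auto intro: mult_left_mono_neg)
    then have "(\<Sum>j\<in>I. A m j * v j) \<le> (\<Sum>j\<in>I. A m j) * v m"
      by (simp add: sum_distrib_right sum_mono)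
    also have "\<dots> \<le> 0" using row[OF m(1)] neg by (simp add: mult_nonneg_nonpos)
    finally have "c * (\<Sum>j\<in>I. A m j * v j) \<le> 0" using \<open>c \<ge> 0\<close> by (simp add: mult_nonneg_nonpos)
    with w[OF m(1)] neg show False by linarith
  qed
  then show ?thesis using m(2)[OF \<open>i \<in> I\<close>] by linarith
qed

text \<open>The vector \<open>1 - v\<close> satisfies the hypothesis of the lower bound too: \<open>A\<close> maps the constant vector 1 to
  the row sums, which are nonnegative.\<close>

lemma implicit_step_unit_interval:
  fixes A :: "'i \<Rightarrow> 'i \<Rightarrow> real"
  assumes I: "finite I" "c \<ge> 0"
    and off: "\<And>i j. i \<in> I \<Longrightarrow> j \<in> I \<Longrightarrow> i \<noteq> j \<Longrightarrow> A i j \<le> 0"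
    and row: "\<And>i. i \<in> I \<Longrightarrow> (\<Sum>j\<in>I. A i j) \<ge> 0"
    and w: "\<And>i. i \<in> I \<Longrightarrow> v i + c * (\<Sum>j\<in>I. A i j * v j) \<in> {0..1}"
    and "i \<in> I"
  shows "v i \<in> {0..1}"
proof -
  have "v i \<ge> 0"
    by (rule implicit_step_nonneg[OF I off row _ \<open>i \<in> I\<close>]) (use w in auto)
  moreover have "1 - v i \<ge> 0"
  proof (rule implicit_step_nonneg[OF I off row _ \<open>i \<in> I\<close>])
    fix k assume "k \<in> I"
    have "(\<Sum>j\<in>I. A k j * (1 - v j)) = (\<Sum>j\<in>I. A k j) - (\<Sum>j\<in>I. A k j * v j)"
      by (simp add: right_diff_distrib sum_subtractf)
    moreover have "c * (\<Sum>j\<in>I. A k j) \<ge> 0" using row[OF \<open>k \<in> I\<close>] I(2) by simp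
    ultimately show "1 - v k + c * (\<Sum>j\<in>I. A k j * (1 - v j)) \<ge> 0"
      using w[OF \<open>k \<in> I\<close>] by (simp add: right_diff_distrib)
  qed auto
  ultimately show ?thesis by simp
qed

text \<open>The explicit step multiplies \<open>u\<close> by \<open>1 - \<tau> (u - 1) (2 u - 1) / 2\<close>. The product \<open>(u - 1) (2 u - 1)\<close> is
  largest at \<open>u = 0\<close>, with value 1, which is the origin of the bound \<open>\<tau> \<le> 2\<close>.\<close>

lemma explicit_reaction_nonneg:
  assumes "0 < \<tau>" "\<tau> \<le> 2" and "0 \<le> u" "u \<le> 1"
  shows "0 \<le> u - \<tau> * reaction u"
proof -
  have "(u - 1) * (2 * u - 1) = 1 - u * (3 - 2 * u)" by (simp add: algebra_simps)
  then have "(u - 1) * (2 * u - 1) \<le> 1" using assms by simp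
  then have "\<tau> * ((u - 1) * (2 * u - 1)) \<le> \<tau> * 1"
    using assms by (intro mult_left_mono) auto
  with assms(2) have le: "\<tau> * ((u - 1) * (2 * u - 1)) \<le> 2" by linarith
  have "0 \<le> u * (1 - \<tau> * ((u - 1) * (2 * u - 1)) / 2)"
    by (rule mult_nonneg_nonneg) (use assms le in simp_all)
  then show ?thesis by (simp add: reaction_def algebra_simps)
qed

text \<open>The reaction is odd about \<open>u = 1 / 2\<close>, so the upper bound is the lower one for \<open>1 - u\<close>.\<close>

lemma explicit_reaction_unit_interval:
  assumes "0 < \<tau>" "\<tau> \<le> 2" and "u \<in> {0..1}"
  shows "u - \<tau> * reaction u \<in> {0..1}"
proof -
  have "reaction (1 - u) = - reaction u"
    by (simp add: reaction_def field_simps)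
  then show ?thesis
    using explicit_reaction_nonneg[of \<tau> u] explicit_reaction_nonneg[of \<tau> "1 - u"] assms by simp
qed

theorem theorem2:
  fixes a b \<epsilon> s \<tau> h :: real
    and N :: nat
    and u0 :: "real \<Rightarrow> real"
    and U :: "nat \<Rightarrow> real vec"
  assumes "a < b" and "N \<ge> 2" and "\<epsilon> > 0"
    and h: "h = mesh_size a b N"
    and s: "s0 < s" "s \<le> 1"
    and dim: "\<And>n. U n \<in> carrier_vec (N - 1)"
    and scheme: "\<And>n. (1 / \<tau>) \<cdot>\<^sub>v (U (Suc n) - U n)
        + (\<epsilon>\<^sup>2 / h) \<cdot>\<^sub>v (stiffness_mat s h N *\<^sub>v U (Suc n))
        + map_vec reaction (U n) = 0\<^sub>v (N - 1)"
    and init: "\<And>j. 1 \<le> j \<Longrightarrow> j \<le> N - 1 \<Longrightarrow> U 0 $ (j - 1) = u0 (mesh_node a b N j)"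
    and u0: "\<And>x. a < x \<Longrightarrow> x < b \<Longrightarrow> 0 \<le> u0 x \<and> u0 x \<le> 1"
    and \<tau>: "0 < \<tau>" "\<tau> \<le> 2"
  shows "\<forall>n. \<forall>j. 1 \<le> j \<and> j \<le> N - 1 \<longrightarrow> 0 \<le> U n $ (j - 1) \<and> U n $ (j - 1) \<le> 1"
proof -
  have "h > 0" using \<open>a < b\<close> \<open>N \<ge> 2\<close> by (simp add: h mesh_size_def)
  interpret stiffness_profile "fractional_profile s h"
    by (rule stiffness_profile_fractional[OF s \<open>h > 0\<close>])
  define I where "I = {..<N - 1}"
  define A where "A i j = stiffness_entry s h \<bar>int i - int j\<bar>" for i j :: nat
  have step: "U (Suc n) $ k + (\<tau> * \<epsilon>\<^sup>2 / h) * (\<Sum>j\<in>I. A k j * U (Suc n) $ j)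
      = U n $ k - \<tau> * reaction (U n $ k)" if "k \<in> I" for n k
  proof -
    have k: "k < N - 1" using that by (simp add: I_def)
    have d: "dim_vec (U m) = N - 1" for m using dim by simp
    have "(stiffness_mat s h N *\<^sub>v U (Suc n)) $ k = (\<Sum>j\<in>I. A k j * U (Suc n) $ j)"
      using k d by (simp add: stiffness_mat_def scalar_prod_def I_def A_def atLeast0LessThan)
    moreover have "((1 / \<tau>) \<cdot>\<^sub>v (U (Suc n) - U n)
        + (\<epsilon>\<^sup>2 / h) \<cdot>\<^sub>v (stiffness_mat s h N *\<^sub>v U (Suc n)) + map_vec reaction (U n)) $ k = 0"
      using scheme k by simp
    ultimately have "(U (Suc n) $ k - U n $ k) / \<tau>
        + (\<epsilon>\<^sup>2 / h) * (\<Sum>j\<in>I. A k j * U (Suc n) $ j) + reaction (U n $ k) = 0"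
      using k d by (simp add: stiffness_mat_def)
    then have "\<tau> * ((U (Suc n) $ k - U n $ k) / \<tau>
        + (\<epsilon>\<^sup>2 / h) * (\<Sum>j\<in>I. A k j * U (Suc n) $ j) + reaction (U n $ k)) = 0"
      by simp
    then show ?thesis using \<open>0 < \<tau>\<close> by (simp add: distrib_left)
  qed
  have bounds: "\<forall>k\<in>I. U n $ k \<in> {0..1}" for n
  proof (induction n)
    case 0
    show ?case
    proof
      fix k assume "k \<in> I"
      then have k: "k < N - 1" by (simp add: I_def)
      have "real (Suc k) * h < real N * h"
        using k \<open>h > 0\<close> by (intro mult_strict_right_mono) auto
      moreover have "real N * h = b - a" using \<open>N \<ge> 2\<close> by (simp add: h mesh_size_def)
      moreover have "real (Suc k) * h > 0" using \<open>h > 0\<close> by simp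
      ultimately have "a < mesh_node a b N (Suc k)" "mesh_node a b N (Suc k) < b"
        unfolding mesh_node_def h[symmetric] by linarith+
      then show "U 0 $ k \<in> {0..1}" using init[of "Suc k"] u0 k by simp
    qed
  next
    case (Suc n)
    show ?case
    proof
      fix k assume "k \<in> I"
      show "U (Suc n) $ k \<in> {0..1}"
      proof (rule implicit_step_unit_interval[of I "\<tau> * \<epsilon>\<^sup>2 / h" A])
        show "A i j \<le> 0" if "i \<noteq> j" for i j
          using off_diagonal_nonpos[of "\<bar>int i - int j\<bar>"] that by (simp add: A_def stiffness_entry_eq)
        show "(\<Sum>j\<in>I. A i j) \<ge> 0" if "i \<in> I" for i
          using row_sum_nonneg[of i "N - 1"] that by (simp add: A_def I_def stiffness_entry_eq)
        show "U (Suc n) $ i + \<tau> * \<epsilon>\<^sup>2 / h * (\<Sum>j\<in>I. A i j * U (Suc n) $ j) \<in> {0..1}"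
          if "i \<in> I" for i
          unfolding step[OF that] using Suc.IH that \<tau> by (intro explicit_reaction_unit_interval) auto
      qed (use \<tau> \<open>h > 0\<close> \<open>k \<in> I\<close> in \<open>auto simp: I_def\<close>)
    qed
  qed
  show ?thesis
  proof (intro allI impI)
    fix n j assume "1 \<le> j \<and> j \<le> N - 1"
    then have "j - 1 \<in> I" by (auto simp: I_def)
    then show "0 \<le> U n $ (j - 1) \<and> U n $ (j - 1) \<le> 1" using bounds[of n] by auto
  qed
qed

end
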